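(* Let $n\ge 1$ be an integer, and let $a<0$ and $\beta>-1$ be fixed. For $\alpha>-1$ let $x_1(\alpha)<\cdots<x_{2n}(\alpha)$ be the zeros of the diagonal Jacobi-Laguerre polynomial $L_{n,n}^{(\alpha,\beta)}(x;a)$. Then each zero $x_j(\alpha)$, $j=1,\ldots,2n$, is an increasing function of the parameter $\alpha\in(-1,\infty)$.
   Context: For $a<0$ and $\alpha,\beta>-1$, the (diagonal, type II) Jacobi-Laguerre multiple orthogonal polynomial $L_{n,n}^{(\alpha,\beta)}(x;a)$ is the unique monic polynomial of degree $2n$ satisfying $$\int_a^0 x^k L_{n,n}^{(\alpha,\beta)}(x;a)(x-a)^\alpha|x|^\beta e^{-x}\,dx=0,\qquad \int_0^{+\infty} x^k L_{n,n}^{(\alpha,\beta)}(x;a)(x-a)^\alpha x^\beta e^{-x}\,dx=0$$ for $k=0,\ldots,n-1$. It is known that it has $n$ simple zeros in $(a,0)$ and $n$ simple zeros in $(0,+\infty)$. "Increasing" is meant in the strict sense. *)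

theory Defs
  imports "HOL-Analysis.Analysis" "HOL-Computational_Algebra.Polynomial"
begin

(* Both integrands below are Lebesgue integrable whenever a < 0 and \<alpha>, \<beta> > -1, so the
   convention that a non-integrable function has integral 0 plays no role there. *)
definition is_jacobi_laguerre :: "nat \<Rightarrow> real \<Rightarrow> real \<Rightarrow> real \<Rightarrow> real poly \<Rightarrow> bool" where
  "is_jacobi_laguerre n \<alpha> \<beta> a p \<longleftrightarrow>
     degree p = 2 * n \<and> lead_coeff p = 1 \<and>
     (\<forall>k<n. (LBINT x:{a<..<0}.
               x ^ k * poly p x * (x - a) powr \<alpha> * \<bar>x\<bar> powr \<beta> * exp (- x)) = 0) \<and>
     (\<forall>k<n. (LBINT x:{0<..}.
               x ^ k * poly p x * (x - a) powr \<alpha> * x powr \<beta> * exp (- x)) = 0)"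

definition jacobi_laguerre :: "nat \<Rightarrow> real \<Rightarrow> real \<Rightarrow> real \<Rightarrow> real poly" where
  "jacobi_laguerre n \<alpha> \<beta> a = (THE p. is_jacobi_laguerre n \<alpha> \<beta> a p)"

(* Zeros are numbered from 1 in increasing order. All 2 * n zeros of the polynomial are real
   and simple, so the set of real roots has exactly 2 * n elements and the list index is in
   range for 1 \<le> j \<le> 2 * n. *)
definition jacobi_laguerre_zero :: "nat \<Rightarrow> real \<Rightarrow> real \<Rightarrow> real \<Rightarrow> nat \<Rightarrow> real" where
  "jacobi_laguerre_zero n \<alpha> \<beta> a j =
     sorted_list_of_set {x. poly (jacobi_laguerre n \<alpha> \<beta> a) x = 0} ! (j - 1)"

end

theory Submission
  imports Defs "HOL-Real_Asymp.Real_Asymp"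
begin

text \<open>
  The orthogonality relations have a solution in closed form, and its recursive structure alone
  forces the monotonicity, without any differentiation with respect to \<open>\<alpha>\<close>.

  Write \<open>w\<^sub>\<alpha>\<^sub>\<beta>(x) = (x - a)\<^sup>\<alpha> |x|\<^sup>\<beta> e\<^sup>-\<^sup>x\<close>. For a polynomial \<open>g\<close>, the derivative of
  \<open>g(x) (x - a) x w\<^sub>\<alpha>\<^sub>\<beta>(x)\<close> is \<open>(T g)(x) w\<^sub>\<alpha>\<^sub>\<beta>(x)\<close> for a first-order differential operator \<open>T\<close>
  (called \<open>raise\<close> below). Up to sign, \<open>(x - a) x w\<^sub>\<alpha>\<^sub>\<beta>\<close> is the weight with both parameters shifted
  by one, so integration by parts on \<open>(a, 0)\<close> and on \<open>(0, \<infinity>)\<close> (lemma \<open>jl_rodrigues_orthogonal\<close>)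
  shows that \<open>-T\<close> turns the polynomial of index \<open>n\<close> for \<open>(\<alpha> + 1, \<beta> + 1)\<close> into the one of index
  \<open>n + 1\<close> for \<open>(\<alpha>, \<beta>)\<close>. Iterating from the constant \<open>1\<close> gives the Rodrigues formula; a count of
  sign changes (lemma \<open>orthogonal_eq_0\<close>) shows that nothing else solves the relations.

  If \<open>g\<close> has the simple zeros \<open>y\<^sub>i\<close>, none of them \<open>a\<close> or \<open>0\<close>, the zeros of \<open>T g\<close> are exactly
  the solutions of \<open>(\<alpha> + 1) / (x - a) + (\<beta> + 1) / x + (\<Sum>i. 1 / (x - y\<^sub>i)) = 1\<close>.
  The left-hand side is decreasing between its poles, so there is one solution between any two
  consecutive poles and one to the right of all of them. Increasing \<open>\<alpha>\<close> increases the residue at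
  the leftmost pole and, by induction on \<open>n\<close>, moves the poles \<open>y\<^sub>i\<close> to the right. Both changes
  increase the left-hand side at every point that no pole passes, hence move every solution
  strictly to the right (lemma \<open>interlacing_solution_less\<close>).
\<close>

section \<open>Sums of simple poles with positive residues\<close>

definition pole_sum :: "nat \<Rightarrow> (nat \<Rightarrow> real) \<Rightarrow> (nat \<Rightarrow> real) \<Rightarrow> real \<Rightarrow> real" where
  "pole_sum m c p x = (\<Sum>i<m. c i / (x - p i))"

text \<open>The last component of \<open>x\<close> lies to the right of all poles and is otherwise unconstrained.\<close>

definition interlacing_solutions ::
  "nat \<Rightarrow> (nat \<Rightarrow> real) \<Rightarrow> (nat \<Rightarrow> real) \<Rightarrow> (nat \<Rightarrow> real) \<Rightarrow> bool" where
  "interlacing_solutions m c p x \<longleftrightarrow>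
     (\<forall>i<m. p i < x i \<and> (Suc i < m \<longrightarrow> x i < p (Suc i)) \<and> pole_sum m c p (x i) = 1)"

lemma pole_sum_strict_antimono:
  assumes "m > 0" and c: "\<And>i. i < m \<Longrightarrow> c i > 0"
    and "x < x'" and sep: "\<And>i. i < m \<Longrightarrow> p i < x \<or> x' < p i"
  shows "pole_sum m c p x' < pole_sum m c p x"
  unfolding pole_sum_def
proof (rule sum_strict_mono)
  fix i assume "i \<in> {..<m}"
  hence i: "c i > 0" "p i < x \<or> x' < p i" using c sep by auto
  hence "(x - p i) * (x' - p i) > 0"
    using \<open>x < x'\<close> by (auto intro: mult_pos_pos mult_neg_neg)
  moreover have "c i * (x - p i) < c i * (x' - p i)"
    using i \<open>x < x'\<close> by simp
  ultimately show "c i / (x' - p i) < c i / (x - p i)"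
    using i \<open>x < x'\<close> by (auto simp: divide_simps split: if_splits)
qed (use \<open>m > 0\<close> in auto)

text \<open>
  Just right of a pole the sum is near \<open>+\<infinity>\<close>; just left of the next one it is near \<open>-\<infinity>\<close>, and
  far to the right it is near \<open>0 < 1\<close>. The intermediate value theorem gives a solution in each case.
\<close>

lemma pole_sum_solution_exists:
  assumes c: "\<And>i. i < m \<Longrightarrow> c i > 0"
    and p: "\<And>i j. i < j \<Longrightarrow> j < m \<Longrightarrow> p i < p j" and "i < m"
  shows "\<exists>x>p i. (Suc i < m \<longrightarrow> x < p (Suc i)) \<and> pole_sum m c p x = 1"
proof -
  have split: "pole_sum m c p = (\<lambda>x. (\<Sum>j\<in>{..<m}-{k}. c j / (x - p j)) + c k / (x - p k))"
    if "k < m" for k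
    using that by (auto simp: pole_sum_def fun_eq_iff sum.remove[of "{..<m}" k])
  have ne: "p j \<noteq> p k" if "j < m" "k < m" "j \<noteq> k" for j k
    using p[of j k] p[of k j] that by (metis nat_neq_iff order_less_irrefl)
  have rest: "isCont (\<lambda>x. \<Sum>j\<in>{..<m}-{k}. c j / (x - p j)) (p k)" if "k < m" for k
    using ne that by (intro continuous_intros) auto
  have rest_right: "((\<lambda>x. \<Sum>j\<in>{..<m}-{k}. c j / (x - p j)) \<longlongrightarrow> (\<Sum>j\<in>{..<m}-{k}. c j / (p k - p j))) (at_right (p k))"
    and rest_left: "((\<lambda>x. \<Sum>j\<in>{..<m}-{k}. c j / (x - p j)) \<longlongrightarrow> (\<Sum>j\<in>{..<m}-{k}. c j / (p k - p j))) (at_left (p k))"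
    if "k < m" for k
    using rest[OF that] unfolding isCont_def
    by (blast intro: tendsto_mono[OF at_le] subset_UNIV)+
  have pos: "filterlim (\<lambda>x. c k / (x - p k)) at_top (at_right (p k))" if "k < m" for k
    using c[OF that] by real_asymp
  have neg: "filterlim (\<lambda>x. c k / (x - p k)) at_bot (at_left (p k))" if "k < m" for k
    using c[OF that] by real_asymp
  have right: "filterlim (pole_sum m c p) at_top (at_right (p k))" if "k < m" for k
    unfolding split[OF that]
    by (rule filterlim_tendsto_add_at_top[OF rest_right[OF that] pos[OF that]])
  have left: "filterlim (pole_sum m c p) at_bot (at_left (p k))" if "k < m" for k
    unfolding split[OF that]
    using filterlim_tendsto_add_at_top[OF tendsto_minus[OF rest_left[OF that]]
      filterlim_uminus_at_bot[THEN iffD1, OF neg[OF that]]]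
    by (subst filterlim_uminus_at_bot) simp
  have infty: "(pole_sum m c p \<longlongrightarrow> 0) at_top"
  proof -
    have "((\<lambda>x. c j / (x - p j)) \<longlongrightarrow> 0) at_top" for j by real_asymp
    hence "(pole_sum m c p \<longlongrightarrow> (\<Sum>j<m. 0)) at_top"
      unfolding pole_sum_def [abs_def] by (intro tendsto_sum)
    thus ?thesis by simp
  qed
  define u where "u = (if Suc i < m then p (Suc i) else p i + 1)"
  have u: "p i < u" using p[of i "Suc i"] by (auto simp: u_def)
  have "eventually (\<lambda>x. 1 < pole_sum m c p x) (at_right (p i))"
    using right[OF \<open>i < m\<close>] by (simp add: filterlim_at_top_dense)
  moreover have "eventually (\<lambda>x. x \<in> {p i<..<u}) (at_right (p i))"
    using u by (rule eventually_at_right_real)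
  ultimately have "eventually (\<lambda>x. 1 < pole_sum m c p x \<and> x \<in> {p i<..<u}) (at_right (p i))"
    by (rule eventually_conj)
  then obtain x1 where x1: "1 < pole_sum m c p x1" "p i < x1" "x1 < u"
    using eventually_happens[of _ "at_right (p i)"] by force
  have "\<exists>x2>x1. pole_sum m c p x2 < 1 \<and> (Suc i < m \<longrightarrow> x2 < p (Suc i))"
  proof (cases "Suc i < m")
    case True
    hence x1u: "x1 < p (Suc i)" using x1 by (simp add: u_def)
    have "eventually (\<lambda>x. pole_sum m c p x < 1) (at_left (p (Suc i)))"
      using left[OF True] by (simp add: filterlim_at_bot_dense)
    moreover have "eventually (\<lambda>x. x \<in> {x1<..<p (Suc i)}) (at_left (p (Suc i)))"
      using x1u by (rule eventually_at_left_real)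
    ultimately have "eventually (\<lambda>x. pole_sum m c p x < 1 \<and> x \<in> {x1<..<p (Suc i)}) (at_left (p (Suc i)))"
      by (rule eventually_conj)
    thus ?thesis
      using eventually_happens[of _ "at_left (p (Suc i))"] by force
  next
    case False
    have "eventually (\<lambda>x. pole_sum m c p x < 1) at_top"
      using infty by (rule order_tendstoD) simp
    hence "eventually (\<lambda>x. pole_sum m c p x < 1 \<and> x > x1) at_top"
      using eventually_gt_at_top by (rule eventually_conj)
    thus ?thesis using False
      using eventually_happens[of _ "at_top :: real filter"] by force
  qed
  then obtain x2 where x2: "x1 < x2" "pole_sum m c p x2 < 1" "Suc i < m \<longrightarrow> x2 < p (Suc i)"
    by blast
  have avoid: "p j \<notin> {x1..x2}" if "j < m" for j
  proof -
    consider "j \<le> i" | "j = Suc i" | "j > Suc i" by linarith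
    thus ?thesis
    proof cases
      case 1
      hence "p j \<le> p i" using p[of j i] \<open>i < m\<close> by (cases "j = i") auto
      thus ?thesis using x1 by auto
    next
      case 2
      thus ?thesis using x2 that by auto
    next
      case 3
      hence "p (Suc i) < p j" using p that by blast
      thus ?thesis using x2 3 that by auto
    qed
  qed
  have "continuous_on {x1..x2} (pole_sum m c p)"
    unfolding pole_sum_def [abs_def] using avoid
    by (intro continuous_intros) auto
  then obtain x where "x1 \<le> x" "x \<le> x2" "pole_sum m c p x = 1"
    using IVT2'[of "pole_sum m c p" x2 1 x1] x1 x2 by auto
  thus ?thesis using x1 x2 by (intro exI[of _ x]) auto
qed

lemma interlacing_solutions_exist:
  assumes "\<And>i. i < m \<Longrightarrow> c i > 0" and "\<And>i j. i < j \<Longrightarrow> j < m \<Longrightarrow> p i < p j"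
  obtains x where "interlacing_solutions m c p x"
proof -
  have "\<forall>i. \<exists>x. i < m \<longrightarrow> p i < x \<and> (Suc i < m \<longrightarrow> x < p (Suc i)) \<and> pole_sum m c p x = 1"
  proof
    fix i
    show "\<exists>x. i < m \<longrightarrow> p i < x \<and> (Suc i < m \<longrightarrow> x < p (Suc i)) \<and> pole_sum m c p x = 1"
      using pole_sum_solution_exists[where m = m and c = c and p = p, OF assms] by blast
  qed
  from choice[OF this] show ?thesis
    using that unfolding interlacing_solutions_def by blast
qed

text \<open>
  Moving a pole to the right increases its term on either side of it, but raising a residue does so
  only to the right of the pole. This is why the residues may change only at the leftmost pole. The
  comparison of the two sums at \<open>x i\<close> is needed only if \<open>p' i < x i\<close>, because otherwise
  \<open>x i \<le> p' i < x' i\<close>; then \<open>x i\<close> is on the same side of \<open>p j\<close> and of \<open>p' j\<close> for every \<open>j\<close>.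
\<close>

lemma interlacing_solution_less:
  assumes c: "\<And>i. i < m \<Longrightarrow> c i > 0" "\<And>i. i < m \<Longrightarrow> c' i > 0"
    and c0: "c 0 < c' 0" "p' 0 = p 0" and c_eq: "\<And>i. 0 < i \<Longrightarrow> i < m \<Longrightarrow> c' i = c i"
    and p: "\<And>i j. i < j \<Longrightarrow> j < m \<Longrightarrow> p i < p j"
    and p': "\<And>i j. i < j \<Longrightarrow> j < m \<Longrightarrow> p' i < p' j"
    and le: "\<And>i. i < m \<Longrightarrow> p i \<le> p' i"
    and sol: "interlacing_solutions m c p x" "interlacing_solutions m c' p' x'" and "i < m"
  shows "x i < x' i"
proof (rule ccontr)
  have x: "p i < x i" "Suc i < m \<Longrightarrow> x i < p (Suc i)" "pole_sum m c p (x i) = 1"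
    and x': "p' i < x' i" "pole_sum m c' p' (x' i) = 1"
    using sol \<open>i < m\<close> by (auto simp: interlacing_solutions_def)
  assume "\<not> x i < x' i"
  hence px: "p' i < x i" using x' by simp
  have side: "p' j \<le> p' i \<and> p j \<le> p i \<and> j \<le> i \<or> x i < p j \<and> j > i" if "j < m" for j
  proof -
    consider "j = i" | "j < i" | "j = Suc i" | "j > Suc i" by linarith
    thus ?thesis
    proof cases
      case 4
      thus ?thesis using p[of "Suc i" j] x(2) that by auto
    qed (use p[of j i] p'[of j i] x(2) that \<open>i < m\<close> in auto)
  qed
  have "pole_sum m c p (x i) < pole_sum m c' p' (x i)"
    unfolding pole_sum_def
  proof (rule sum_strict_mono_ex1)
    show "\<exists>j\<in>{..<m}. c j / (x i - p j) < c' j / (x i - p' j)"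
    proof (rule bexI[of _ 0])
      have "p 0 < x i" using side[of 0] \<open>i < m\<close> x by auto
      thus "c 0 / (x i - p 0) < c' 0 / (x i - p' 0)"
        using c0 by (simp add: divide_strict_right_mono)
    qed (use \<open>i < m\<close> in auto)
    show "\<forall>j\<in>{..<m}. c j / (x i - p j) \<le> c' j / (x i - p' j)"
    proof
      fix j assume "j \<in> {..<m}"
      hence j: "j < m" by simp
      have "0 < (x i - p j) * (x i - p' j)"
        using side[OF j] le[OF j] px x(1) by (auto intro: mult_pos_pos mult_neg_neg)
      hence "c j / (x i - p j) \<le> c j / (x i - p' j)"
        using le[OF j] c(1)[OF j] by (intro divide_left_mono) auto
      also have "c j / (x i - p' j) \<le> c' j / (x i - p' j)"
      proof (cases "j = 0")
        case True
        thus ?thesis using side[OF j] px c0 by (auto intro!: divide_right_mono)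
      qed (use c_eq[of j] j in auto)
      finally show "c j / (x i - p j) \<le> c' j / (x i - p' j)" .
    qed
  qed simp
  moreover have "pole_sum m c' p' (x i) \<le> pole_sum m c' p' (x' i)"
  proof (cases "x' i = x i")
    case False
    have "p' j < x' i \<or> x i < p' j" if "j < m" for j
      using side[OF that] le[OF that] x' by auto
    thus ?thesis
      using False \<open>\<not> x i < x' i\<close> \<open>i < m\<close> c(2)
      by (intro less_imp_le pole_sum_strict_antimono) auto
  qed simp
  ultimately show False using x x' by simp
qed

section \<open>The raising operator and its iterates\<close>

text \<open>
  The factor \<open>[:0, - a, 1:]\<close> is \<open>x (x - a)\<close>, and the factor of \<open>g\<close> is \<open>x (x - a)\<close> times the
  logarithmic derivative of \<open>(x - a) powr (\<alpha> + 1) * \<bar>x\<bar> powr (\<beta> + 1) * exp (- x)\<close>.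
\<close>

definition raise :: "real \<Rightarrow> real \<Rightarrow> real \<Rightarrow> real poly \<Rightarrow> real poly" where
  "raise a \<alpha> \<beta> g = [:0, - a, 1:] * pderiv g +
     (smult (\<alpha> + 1) [:0, 1:] + smult (\<beta> + 1) [:- a, 1:] - [:0, - a, 1:]) * g"

text \<open>
  For \<open>x > 0\<close> the value at \<open>x\<close> is \<open>(-1) ^ n\<close> times the \<open>n\<close>-th derivative of
  \<open>(x - a)\<^sup>\<alpha>\<^sup>+\<^sup>n x\<^sup>\<beta>\<^sup>+\<^sup>n e\<^sup>-\<^sup>x\<close>, divided by the weight \<open>(x - a)\<^sup>\<alpha> x\<^sup>\<beta> e\<^sup>-\<^sup>x\<close>; the sign makes the
  polynomial monic.
\<close>

fun jl_rodrigues :: "real \<Rightarrow> nat \<Rightarrow> real \<Rightarrow> real \<Rightarrow> real poly" where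
  "jl_rodrigues a 0 \<alpha> \<beta> = 1"
| "jl_rodrigues a (Suc n) \<alpha> \<beta> = - raise a \<alpha> \<beta> (jl_rodrigues a n (\<alpha> + 1) (\<beta> + 1))"

lemma degree_raise:
  assumes "lead_coeff g = 1"
  shows "degree (- raise a \<alpha> \<beta> g) = degree g + 2" and "lead_coeff (- raise a \<alpha> \<beta> g) = 1"
proof -
  \<comment> \<open>everything but the leading part \<open>x (x - a) g\<close>\<close>
  define r where "r = - ([:0, - a, 1:] * pderiv g +
     (smult (\<alpha> + 1) [:0, 1:] + smult (\<beta> + 1) [:- a, 1:]) * g)"
  have g: "g \<noteq> 0" using assms by auto
  have eq: "- raise a \<alpha> \<beta> g = [:0, - a, 1:] * g + r"
  proof -
    have "- (p * h + (q - p) * g) = p * g + - (p * h + q * g)" for p q h :: "real poly"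
      by (simp add: algebra_simps)
    thus ?thesis unfolding raise_def r_def .
  qed
  have d: "degree ([:0, - a, 1:] * g) = degree g + 2"
    using g by (subst degree_mult_eq) auto
  have "degree ([:0, - a, 1:] * pderiv g) \<le> degree g + 1"
  proof (cases "degree g = 0")
    case True
    then obtain c where "g = [:c:]" by (rule degree_eq_zeroE)
    thus ?thesis by simp
  next
    case False
    have "degree ([:0, - a, 1:] * pderiv g) \<le> 2 + (degree g - 1)"
      by (rule order.trans[OF degree_mult_le]) (simp add: degree_pderiv)
    thus ?thesis using False by simp
  qed
  moreover have "degree ((smult (\<alpha> + 1) [:0, 1:] + smult (\<beta> + 1) [:- a, 1:]) * g) \<le> 1 + degree g"
    by (rule order.trans[OF degree_mult_le]) simp
  ultimately have "degree r < degree g + 2"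
    unfolding r_def degree_minus by (intro le_less_trans[OF degree_add_le[of _ "degree g + 1"]]) auto
  hence r: "degree r < degree ([:0, - a, 1:] * g)" using d by simp
  show "degree (- raise a \<alpha> \<beta> g) = degree g + 2"
    unfolding eq degree_add_eq_left[OF r] d ..
  show "lead_coeff (- raise a \<alpha> \<beta> g) = 1"
  proof -
    have "lead_coeff ([:0, - a, 1:] * g + r) = lead_coeff ([:0, - a, 1:] * g)"
      using r by (metis add.commute lead_coeff_add_le)
    thus ?thesis unfolding eq lead_coeff_mult using assms by simp
  qed
qed

lemma jl_rodrigues_monic:
  "degree (jl_rodrigues a n \<alpha> \<beta>) = 2 * n" "lead_coeff (jl_rodrigues a n \<alpha> \<beta>) = 1"
proof (induction n arbitrary: \<alpha> \<beta>)
  case (Suc n)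
  { case 1 show ?case using degree_raise(1)[OF Suc(2)] Suc(1) by simp
  next case 2 show ?case using degree_raise(2)[OF Suc(2)] by simp }
qed simp_all

section \<open>Zeros of the raised polynomial\<close>

lemma prod_roots_monic:
  fixes y :: "nat \<Rightarrow> real"
  shows "degree (\<Prod>i<m. [:- y i, 1:]) = m" "lead_coeff (\<Prod>i<m. [:- y i, 1:]) = 1"
proof -
  show "degree (\<Prod>i<m. [:- y i, 1:]) = m"
    by (subst degree_prod_eq_sum_degree) auto
  show "lead_coeff (\<Prod>i<m. [:- y i, 1:]) = 1"
    unfolding lead_coeff_prod by simp
qed

lemma poly_prod_roots_eq_0_iff:
  fixes y :: "nat \<Rightarrow> real"
  shows "poly (\<Prod>i<m. [:- y i, 1:]) z = 0 \<longleftrightarrow> z \<in> y ` {..<m}"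
  by (auto simp: poly_prod prod_zero_iff)

lemma log_derivative_prod_roots:
  fixes y :: "nat \<Rightarrow> real"
  assumes "\<And>i. i < m \<Longrightarrow> x \<noteq> y i"
  shows "poly (pderiv (\<Prod>i<m. [:- y i, 1:])) x =
           poly (\<Prod>i<m. [:- y i, 1:]) x * (\<Sum>i<m. 1 / (x - y i))"
  using assms
proof (induction m)
  case (Suc m)
  define q where "q = (\<Prod>i<m. [:- y i, 1:])"
  define s where "s = 1 / (x - y m)"
  have "(x - y m) * s = 1" using Suc.prems[of m] by (simp add: s_def)
  hence "poly q x * ((x - y m) * s) = poly q x" by simp
  moreover have "poly (pderiv q) x = poly q x * (\<Sum>i<m. 1 / (x - y i))"
    unfolding q_def using Suc by simp
  ultimately have "poly (pderiv (q * [:- y m, 1:])) x =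
      poly (q * [:- y m, 1:]) x * ((\<Sum>i<m. 1 / (x - y i)) + s)"
    unfolding pderiv_mult poly_add poly_mult by (simp add: pderiv_pCons algebra_simps)
  thus ?case by (simp only: q_def s_def prod.lessThan_Suc sum.lessThan_Suc)
qed simp

definition separated_zeros :: "real \<Rightarrow> nat \<Rightarrow> real poly \<Rightarrow> (nat \<Rightarrow> real) \<Rightarrow> bool" where
  "separated_zeros a n g y \<longleftrightarrow> g = (\<Prod>i<2 * n. [:- y i, 1:]) \<and>
     (\<forall>i j. i < j \<longrightarrow> j < 2 * n \<longrightarrow> y i < y j) \<and>
     (\<forall>i<n. a < y i \<and> y i < 0) \<and> (\<forall>i<2 * n. n \<le> i \<longrightarrow> 0 < y i)"

text \<open>
  The zeros \<open>y\<close> of a polynomial of degree \<open>2 * n\<close>, half of them on either side of \<open>0\<close>, together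
  with \<open>a\<close> and \<open>0\<close>, listed in increasing order: \<open>0\<close> gets the index \<open>Suc n\<close>.
\<close>

definition poles :: "real \<Rightarrow> nat \<Rightarrow> (nat \<Rightarrow> real) \<Rightarrow> nat \<Rightarrow> real" where
  "poles a n y i = (if i = 0 then a else if i \<le> n then y (i - 1)
     else if i = Suc n then 0 else y (i - 2))"

definition residues :: "real \<Rightarrow> real \<Rightarrow> nat \<Rightarrow> nat \<Rightarrow> real" where
  "residues \<alpha> \<beta> n i = (if i = 0 then \<alpha> + 1 else if i = Suc n then \<beta> + 1 else 1)"

lemma poles_increasing:
  assumes "separated_zeros a n g y" "a < 0" "i < j" "j < 2 * Suc n"
  shows "poles a n y i < poles a n y j"
proof -
  have y: "y k < y l" if "k < l" "l < 2 * n" for k l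
    using assms that by (auto simp: separated_zeros_def)
  have neg: "a < y k" "y k < 0" if "k < n" for k
    using assms that by (auto simp: separated_zeros_def)
  have pos: "0 < y k" if "n \<le> k" "k < 2 * n" for k
    using assms that by (auto simp: separated_zeros_def)
  have above: "a < y k" if "k < 2 * n" for k
    using neg[of k] pos[of k] that \<open>a < 0\<close> by (cases "k < n") auto
  consider "i = 0" "j \<le> n" | "i = 0" "j = Suc n" | "i = 0" "j > Suc n"
    | "0 < i" "j \<le> n" | "0 < i" "i \<le> n" "j = Suc n" | "0 < i" "i \<le> n" "j > Suc n"
    | "i = Suc n" "j > Suc n" | "i > Suc n"
    using \<open>i < j\<close> by linarith
  thus ?thesis
    using \<open>i < j\<close> \<open>j < 2 * Suc n\<close> \<open>a < 0\<close> unfolding poles_def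
    by cases (auto intro: above y neg pos)
qed

lemma pole_sum_poles:
  "pole_sum (2 * Suc n) (residues \<alpha> \<beta> n) (poles a n y) x =
     (\<alpha> + 1) / (x - a) + (\<beta> + 1) / x + (\<Sum>i<2 * n. 1 / (x - y i))"
proof -
  \<comment> \<open>the index of the zero \<open>y i\<close> in the list of poles\<close>
  define h where "h i = (if i < n then Suc i else i + 2)" for i
  define t where "t i = residues \<alpha> \<beta> n i / (x - poles a n y i)" for i
  have h: "inj_on h {..<2 * n}" by (auto simp: inj_on_def h_def split: if_splits)
  have "i \<in> {0, Suc n} \<union> h ` {..<2 * n}" if "i < 2 * Suc n" for i
  proof (cases "i \<le> Suc n")
    case True
    have "i = h (i - 1)" if "i \<noteq> 0" "i \<noteq> Suc n" using that True by (auto simp: h_def)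
    thus ?thesis using True \<open>i < 2 * Suc n\<close> by (cases "i = 0 \<or> i = Suc n") auto
  next
    case False
    hence "i = h (i - 2)" "i - 2 < 2 * n" using that by (auto simp: h_def)
    thus ?thesis by blast
  qed
  hence "{..<2 * Suc n} = {0, Suc n} \<union> h ` {..<2 * n}"
    by (auto simp: h_def)
  moreover have "{0, Suc n} \<inter> h ` {..<2 * n} = {}"
    by (auto simp: h_def split: if_splits)
  ultimately have "sum t {..<2 * Suc n} = sum t {0, Suc n} + sum t (h ` {..<2 * n})"
    by (simp add: sum.union_disjoint)
  also have "sum t {0, Suc n} = (\<alpha> + 1) / (x - a) + (\<beta> + 1) / x"
    by (simp add: t_def residues_def poles_def)
  also have "sum t (h ` {..<2 * n}) = (\<Sum>i<2 * n. 1 / (x - y i))"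
    unfolding sum.reindex[OF h]
    by (intro sum.cong) (auto simp: t_def h_def residues_def poles_def)
  finally show ?thesis by (simp add: pole_sum_def t_def)
qed

text \<open>
  Since \<open>g\<close> has no zeros off the poles, this identifies the zeros of the raised polynomial there with
  the solutions of \<open>pole_sum = 1\<close>.
\<close>

lemma poly_raise_eq_pole_sum:
  assumes g: "separated_zeros a n g y" and "x \<noteq> a" "x \<noteq> 0" and x: "\<And>i. i < 2 * n \<Longrightarrow> x \<noteq> y i"
  shows "poly (- raise a \<alpha> \<beta> g) x = (x - a) * x * poly g x *
           (1 - pole_sum (2 * Suc n) (residues \<alpha> \<beta> n) (poles a n y) x)"
proof -
  define s where "s = (\<Sum>i<2 * n. 1 / (x - y i))"
  define t where "t = (\<alpha> + 1) / (x - a) + (\<beta> + 1) / x"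
  have s: "poly (pderiv g) x = poly g x * s"
    unfolding s_def using log_derivative_prod_roots[OF x] g by (simp add: separated_zeros_def)
  have t: "(\<alpha> + 1) * x + (\<beta> + 1) * (x - a) = (x - a) * x * t"
    unfolding t_def using assms(2,3) by (simp add: divide_simps)
  have "poly (- raise a \<alpha> \<beta> g) x = - ((x - a) * x * poly (pderiv g) x +
      ((\<alpha> + 1) * x + (\<beta> + 1) * (x - a) - (x - a) * x) * poly g x)"
    unfolding raise_def by (simp add: algebra_simps)
  also have "\<dots> = (x - a) * x * poly g x * (1 - (t + s))"
    unfolding s t by (simp add: algebra_simps)
  finally show ?thesis unfolding pole_sum_poles s_def t_def .
qed

text \<open>
  The \<open>2 * n + 2\<close> interlacing solutions exhaust the zeros because the raised polynomial is monic of
  degree \<open>2 * n + 2\<close>. Exactly \<open>n + 1\<close> of them are negative, since the pole \<open>0\<close> has index \<open>Suc n\<close>.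
\<close>

lemma separated_zeros_raise:
  assumes g: "separated_zeros a n g y" and "a < 0"
    and x: "interlacing_solutions (2 * Suc n) (residues \<alpha> \<beta> n) (poles a n y) x"
  shows "separated_zeros a (Suc n) (- raise a \<alpha> \<beta> g) x"
proof -
  let ?p = "poles a n y" and ?m = "2 * Suc n"
  have p: "?p i < ?p j" if "i < j" "j < ?m" for i j
    using poles_increasing[OF g \<open>a < 0\<close> that] .
  have p_le: "?p i \<le> ?p j" if "i \<le> j" "j < ?m" for i j
    using p[of i j] that by (cases "i = j") auto
  have gt: "?p i < x i" if "i < ?m" for i
    using x that unfolding interlacing_solutions_def by blast
  have lt: "x i < ?p (Suc i)" if "Suc i < ?m" for i
    using x that Suc_lessD[OF that] unfolding interlacing_solutions_def by blast
  have sol: "pole_sum ?m (residues \<alpha> \<beta> n) ?p (x i) = 1" if "i < ?m" for i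
    using x that unfolding interlacing_solutions_def by blast
  have mono: "x i < x j" if "i < j" "j < ?m" for i j
    using lt[of i] gt[of j] p_le[of "Suc i" j] that by linarith
  have not_pole: "x i \<noteq> ?p j" if "i < ?m" "j < ?m" for i j
  proof (cases "j \<le> i")
    case True
    thus ?thesis using gt[of i] p_le[of j i] that by linarith
  next
    case False
    thus ?thesis using lt[of i] p_le[of "Suc i" j] that by linarith
  qed
  have p0: "?p 0 = a" and p_Suc_n: "?p (Suc n) = 0" by (auto simp: poles_def)
  hence xa: "x i \<noteq> a" "x i \<noteq> 0" if "i < ?m" for i
    using not_pole[of i 0] not_pole[of i "Suc n"] that by auto
  have xy: "x i \<noteq> y j" if "i < ?m" "j < 2 * n" for i j
  proof (cases "j < n")
    case True
    thus ?thesis using not_pole[of i "Suc j"] that by (simp add: poles_def)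
  next
    case False
    thus ?thesis using not_pole[of i "j + 2"] that by (simp add: poles_def)
  qed
  have root: "poly (- raise a \<alpha> \<beta> g) (x i) = 0" if "i < ?m" for i
    by (subst poly_raise_eq_pole_sum[OF g xa[OF that] xy[OF that]]) (simp_all only: that sol[OF that], simp)
  have inj: "inj_on x {..<?m}"
    using mono by (intro linorder_inj_onI') (auto simp del: mult_Suc_right dest: less_imp_neq)
  have deg_g: "degree g = 2 * n" and lc_g: "lead_coeff g = 1"
    using g prod_roots_monic[where m = "2 * n" and y = y] unfolding separated_zeros_def by blast+
  have "- raise a \<alpha> \<beta> g = (\<Prod>i<?m. [:- x i, 1:])"
  proof (rule poly_eqI_degree_lead_coeff[where n = ?m and A = "x ` {..<?m}"])
    show "poly (- raise a \<alpha> \<beta> g) z = poly (\<Prod>i<?m. [:- x i, 1:]) z" if "z \<in> x ` {..<?m}" for z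
    proof -
      have "poly (- raise a \<alpha> \<beta> g) z = 0" using that root by blast
      moreover have "poly (\<Prod>i<?m. [:- x i, 1:]) z = 0"
        using that unfolding poly_prod_roots_eq_0_iff .
      ultimately show ?thesis by (simp only:)
    qed
    from degree_raise[OF lc_g, of a \<alpha> \<beta>] deg_g prod_roots_monic[where m = ?m and y = x]
    show "coeff (- raise a \<alpha> \<beta> g) ?m = coeff (\<Prod>i<?m. [:- x i, 1:]) ?m"
      "degree (- raise a \<alpha> \<beta> g) \<le> ?m" "degree (\<Prod>i<?m. [:- x i, 1:]) \<le> ?m"
      by simp_all
    show "card (x ` {..<?m}) \<ge> ?m" unfolding card_image[OF inj] by simp
  qed
  moreover have "a < x i \<and> x i < 0" if "i < Suc n" for i
  proof -
    have "i < ?m" "Suc i < ?m" "Suc n < ?m" "0 \<le> i" "Suc i \<le> Suc n" using that by auto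
    thus ?thesis
      using gt[of i] lt[of i] p_le[of 0 i] p_le[of "Suc i" "Suc n"] p0 p_Suc_n by linarith
  qed
  moreover have "0 < x i" if "Suc n \<le> i" "i < ?m" for i
    using gt[of i] p_le[of "Suc n" i] that p_Suc_n by linarith
  ultimately show ?thesis using mono unfolding separated_zeros_def by blast
qed

text \<open>
  In the induction step the zeros of index \<open>n\<close> at \<open>\<alpha> + 1\<close> serve as poles for index \<open>Suc n\<close>. Both
  parameters are treated at once, because comparing the zeros requires that the poles are compared.
\<close>

lemma jl_rodrigues_zeros_increasing:
  assumes "a < 0" "\<alpha> > -1" "\<alpha> < \<alpha>'" "\<beta> > -1"
  shows "\<exists>y y'. separated_zeros a n (jl_rodrigues a n \<alpha> \<beta>) y \<and>
    separated_zeros a n (jl_rodrigues a n \<alpha>' \<beta>) y' \<and> (\<forall>i<2 * n. y i < y' i)"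
  using assms
proof (induction n arbitrary: \<alpha> \<alpha>' \<beta>)
  case 0
  thus ?case by (simp add: separated_zeros_def)
next
  case (Suc n)
  let ?g = "jl_rodrigues a n (\<alpha> + 1) (\<beta> + 1)" and ?g' = "jl_rodrigues a n (\<alpha>' + 1) (\<beta> + 1)"
  have "-1 < \<alpha> + 1" "\<alpha> + 1 < \<alpha>' + 1" "-1 < \<beta> + 1" using Suc.prems by auto
  from Suc.IH[OF \<open>a < 0\<close> this]
  obtain y y' where y: "separated_zeros a n ?g y" and y': "separated_zeros a n ?g' y'"
    and less: "\<forall>i<2 * n. y i < y' i" by blast
  let ?m = "2 * Suc n" and ?c = "residues \<alpha> \<beta> n" and ?c' = "residues \<alpha>' \<beta> n"
  let ?p = "poles a n y" and ?p' = "poles a n y'"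
  have c: "?c i > 0" "?c' i > 0" for i
    using Suc.prems by (auto simp: residues_def)
  have p: "?p i < ?p j" and p': "?p' i < ?p' j" if "i < j" "j < ?m" for i j
    using poles_increasing[OF y \<open>a < 0\<close> that] poles_increasing[OF y' \<open>a < 0\<close> that] .
  have p_le: "?p j \<le> ?p' j" if "j < ?m" for j
  proof -
    have "y (j - 1) \<le> y' (j - 1)" if "j \<noteq> 0" "j \<le> n" using less that by (intro less_imp_le) auto
    moreover have "y (j - 2) \<le> y' (j - 2)" if "j > Suc n"
      using less that \<open>j < ?m\<close> by (intro less_imp_le) auto
    ultimately show ?thesis unfolding poles_def by simp
  qed
  obtain x where x: "interlacing_solutions ?m ?c ?p x"
    by (rule interlacing_solutions_exist[OF c(1) p])
  obtain x' where x': "interlacing_solutions ?m ?c' ?p' x'"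
    by (rule interlacing_solutions_exist[OF c(2) p'])
  have "x i < x' i" if "i < ?m" for i
  proof (rule interlacing_solution_less[where m = ?m and c = ?c and c' = ?c' and p = ?p and p' = ?p'])
    show "?c 0 < ?c' 0" using Suc.prems by (simp add: residues_def)
    show "?p' 0 = ?p 0" by (simp add: poles_def)
    show "?c' j = ?c j" if "0 < j" for j
      using that by (simp add: residues_def)
  qed (use that x x' c p p' p_le in blast)+
  moreover have "separated_zeros a (Suc n) (jl_rodrigues a (Suc n) \<alpha> \<beta>) x"
    unfolding jl_rodrigues.simps by (rule separated_zeros_raise[OF y \<open>a < 0\<close> x])
  moreover have "separated_zeros a (Suc n) (jl_rodrigues a (Suc n) \<alpha>' \<beta>) x'"
    unfolding jl_rodrigues.simps by (rule separated_zeros_raise[OF y' \<open>a < 0\<close> x'])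
  ultimately show ?case by blast
qed

lemma nth_sorted_zeros:
  assumes "separated_zeros a n g y" "i < 2 * n"
  shows "sorted_list_of_set {x. poly g x = 0} ! i = y i"
proof -
  have "{x. poly g x = 0} = y ` {..<2 * n}"
    using assms poly_prod_roots_eq_0_iff by (auto simp: separated_zeros_def)
  also have "sorted_list_of_set (y ` {..<2 * n}) = map y [0..<2 * n]"
  proof (rule strict_sorted_equal)
    show "sorted_wrt (<) (map y [0..<2 * n])"
      using assms by (auto simp: separated_zeros_def sorted_wrt_iff_nth_less)
  qed (auto simp: atLeast0LessThan)
  finally show ?thesis using assms by simp
qed

section \<open>Integrability of the weight\<close>

text \<open>
  Unlike \<open>(x - a) powr \<alpha>\<close>, the base \<open>\<bar>x - a\<bar>\<close> treats the two singularities \<open>a\<close> and \<open>0\<close> alike; on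
  \<open>{a<..}\<close> there is no difference.
\<close>

definition jl_weight :: "real \<Rightarrow> real \<Rightarrow> real \<Rightarrow> real \<Rightarrow> real" where
  "jl_weight a \<alpha> \<beta> x = \<bar>x - a\<bar> powr \<alpha> * \<bar>x\<bar> powr \<beta> * exp (- x)"

lemma abs_powr_set_integrable:
  fixes \<gamma> s c d :: real
  assumes "\<gamma> > -1"
  shows "set_integrable lborel {c..d} (\<lambda>x. \<bar>x - s\<bar> powr \<gamma>)"
proof -
  define b where "b = max \<bar>c - s\<bar> \<bar>d - s\<bar>"
  have "(\<lambda>x. x powr \<gamma>) integrable_on {0..b}"
    using assms by (intro integrable_on_powr_from_0) (auto simp: b_def)
  hence "(\<lambda>x. x powr \<gamma>) absolutely_integrable_on {0..b}"
    by (subst absolutely_integrable_on_iff_nonneg) auto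
  hence right: "integrable lborel (\<lambda>x. indicator {0..b} x *\<^sub>R x powr \<gamma>)"
    unfolding set_integrable_def by (subst (asm) integrable_completion) auto
  \<comment> \<open>The reflected copy covers the part to the left of the singularity; a shift moves that to \<open>s\<close>.\<close>
  have left: "integrable lborel (\<lambda>x. indicator {0..b} (0 + (-1) * x) *\<^sub>R (0 + (-1) * x) powr \<gamma>)"
    using lborel_integrable_real_affine[OF right, of "-1" 0] by simp
  have "integrable lborel (\<lambda>x. indicator {-b..b} x *\<^sub>R \<bar>x\<bar> powr \<gamma>)"
    by (rule Bochner_Integration.integrable_bound[OF Bochner_Integration.integrable_add[OF left right]])
       (auto intro!: AE_I2 simp: indicator_def)
  from lborel_integrable_real_affine[OF this, of 1 "-s"]
  have "set_integrable lborel {s-b..s+b} (\<lambda>x. \<bar>x - s\<bar> powr \<gamma>)"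
    unfolding set_integrable_def
    by (rule Bochner_Integration.integrable_cong[THEN iffD1, rotated -1])
       (auto simp: indicator_def)
  thus ?thesis
    by (rule set_integrable_subset) (auto simp: b_def)
qed

lemma bounded_mult_set_integrable:
  fixes f h :: "real \<Rightarrow> real"
  assumes f: "set_integrable lborel A f"
    and h: "h \<in> borel_measurable borel" and bd: "\<And>x. x \<in> A \<Longrightarrow> \<bar>h x\<bar> \<le> C"
  shows "set_integrable lborel A (\<lambda>x. h x * f x)"
proof -
  have "integrable lborel (\<lambda>x. C * (indicator A x *\<^sub>R f x))"
    using f unfolding set_integrable_def by (rule integrable_mult_right)
  thus ?thesis unfolding set_integrable_def
  proof (rule Bochner_Integration.integrable_bound)
    have "(\<lambda>x. indicator A x *\<^sub>R f x) \<in> borel_measurable lborel"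
      using f unfolding set_integrable_def by (rule borel_measurable_integrable)
    hence "(\<lambda>x. h x * (indicator A x *\<^sub>R f x)) \<in> borel_measurable lborel"
      using h by measurable
    thus "(\<lambda>x. indicator A x *\<^sub>R (h x * f x)) \<in> borel_measurable lborel"
      by (simp add: mult_ac)
    show "AE x in lborel. norm (indicator A x *\<^sub>R (h x * f x)) \<le> norm (C * (indicator A x *\<^sub>R f x))"
    proof (rule AE_I2)
      fix x
      show "norm (indicator A x *\<^sub>R (h x * f x)) \<le> norm (C * (indicator A x *\<^sub>R f x))"
        using bd[of x] by (auto simp: indicator_def abs_mult intro!: mult_right_mono)
    qed
  qed
qed

lemma poly_powr_exp_tendsto_0:
  fixes a c \<alpha> \<beta> :: real
  assumes "c > 0"
  shows "((\<lambda>x. poly q x * (\<bar>x - a\<bar> powr \<alpha> * \<bar>x\<bar> powr \<beta>) * exp (- c * x)) \<longlongrightarrow> 0) at_top"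
proof -
  have "((\<lambda>x. coeff q k * (x ^ k * (\<bar>x - a\<bar> powr \<alpha> * \<bar>x\<bar> powr \<beta>) * exp (- c * x))) \<longlongrightarrow> coeff q k * 0) at_top" for k
  proof -
    have "((\<lambda>x. x powr real k * ((x - a) powr \<alpha> * x powr \<beta>) * exp (- c * x)) \<longlongrightarrow> 0) at_top"
      using assms by real_asymp
    moreover have "eventually (\<lambda>x. x powr real k * ((x - a) powr \<alpha> * x powr \<beta>) * exp (- c * x) =
        x ^ k * (\<bar>x - a\<bar> powr \<alpha> * \<bar>x\<bar> powr \<beta>) * exp (- c * x)) at_top"
      using eventually_gt_at_top[of "max a 0"] by eventually_elim (simp add: powr_realpow)
    ultimately show ?thesis
      by (intro tendsto_mult tendsto_const) (rule Lim_transform_eventually)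
  qed
  hence "((\<lambda>x. \<Sum>k\<le>degree q. coeff q k * (x ^ k * (\<bar>x - a\<bar> powr \<alpha> * \<bar>x\<bar> powr \<beta>) * exp (- c * x)))
           \<longlongrightarrow> (\<Sum>k\<le>degree q. coeff q k * 0)) at_top"
    by (intro tendsto_sum)
  thus ?thesis by (simp add: poly_altdef sum_distrib_right mult.assoc)
qed

lemma continuous_on_Icc_bounded:
  fixes f :: "real \<Rightarrow> real"
  assumes "continuous_on {c..d} f"
  shows "\<exists>C. \<forall>x\<in>{c..d}. \<bar>f x\<bar> \<le> C"
  using compact_imp_bounded[OF compact_continuous_image[OF assms compact_Icc]]
  by (auto simp: bounded_iff)

text \<open>
  Each singularity is split off on an interval where the other factors are bounded. On \<open>{1..}\<close> half of
  the exponential absorbs the powers and the polynomial; the other half is integrable.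
\<close>

lemma poly_jl_weight_set_integrable_Ici:
  assumes "a < 0" "\<alpha> > -1" "\<beta> > -1"
  shows "set_integrable lborel {a..} (\<lambda>x. poly q x * jl_weight a \<alpha> \<beta> x)"
proof -
  have meas: "(\<lambda>x::real. \<bar>x - s\<bar> powr \<gamma>) \<in> borel_measurable borel" for s \<gamma> by measurable
  have measq: "poly q \<in> borel_measurable borel"
    by (intro borel_measurable_continuous_onI continuous_intros)
  have left: "set_integrable lborel {a..a/2} (\<lambda>x. poly q x * jl_weight a \<alpha> \<beta> x)"
  proof -
    let ?h = "\<lambda>x. poly q x * \<bar>x\<bar> powr \<beta> * exp (- x)"
    have "continuous_on {a..a/2} ?h"
      using \<open>a < 0\<close> by (intro continuous_intros) auto
    then obtain C where C: "\<And>x. x \<in> {a..a/2} \<Longrightarrow> \<bar>?h x\<bar> \<le> C"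
      using continuous_on_Icc_bounded by blast
    have "set_integrable lborel {a..a/2} (\<lambda>x. ?h x * \<bar>x - a\<bar> powr \<alpha>)"
      using C measq meas[of 0] by (intro bounded_mult_set_integrable[OF abs_powr_set_integrable[OF \<open>\<alpha> > -1\<close>]]) auto
    thus ?thesis by (simp add: jl_weight_def mult_ac)
  qed
  have mid: "set_integrable lborel {a/2..1} (\<lambda>x. poly q x * jl_weight a \<alpha> \<beta> x)"
  proof -
    let ?h = "\<lambda>x. poly q x * \<bar>x - a\<bar> powr \<alpha> * exp (- x)"
    have "continuous_on {a/2..1} ?h"
      using \<open>a < 0\<close> by (intro continuous_intros) auto
    then obtain C where C: "\<And>x. x \<in> {a/2..1} \<Longrightarrow> \<bar>?h x\<bar> \<le> C"
      using continuous_on_Icc_bounded by blast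
    have "set_integrable lborel {a/2..1} (\<lambda>x. ?h x * \<bar>x - 0\<bar> powr \<beta>)"
      using C measq meas[of a] by (intro bounded_mult_set_integrable[OF abs_powr_set_integrable[OF \<open>\<beta> > -1\<close>]]) auto
    thus ?thesis by (simp add: jl_weight_def mult_ac)
  qed
  have right: "set_integrable lborel {1..} (\<lambda>x. poly q x * jl_weight a \<alpha> \<beta> x)"
  proof -
    let ?h = "\<lambda>x. poly q x * (\<bar>x - a\<bar> powr \<alpha> * \<bar>x\<bar> powr \<beta>) * exp (- (1/2) * x)"
    have "eventually (\<lambda>x. \<bar>?h x\<bar> < 1) at_top"
      using order_tendstoD(2)[OF tendsto_rabs_zero[OF poly_powr_exp_tendsto_0[of "1/2" q a \<alpha> \<beta>]], of 1] by simp
    then obtain R where R: "\<And>x. x \<ge> R \<Longrightarrow> \<bar>?h x\<bar> < 1"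
      by (auto simp: eventually_at_top_linorder)
    have "continuous_on {1..R} ?h"
      using \<open>a < 0\<close> by (intro continuous_intros) auto
    then obtain C where C: "\<And>x. x \<in> {1..R} \<Longrightarrow> \<bar>?h x\<bar> \<le> C"
      using continuous_on_Icc_bounded by blast
    have bd: "\<bar>?h x\<bar> \<le> max 1 C" if "x \<in> {1..}" for x
      using R[of x] C[of x] that by (cases "x \<ge> R") auto
    have "(\<lambda>x::real. exp (- (1/2) * x)) integrable_on {1..}"
      by (rule integrable_on_exp_minus_to_infinity) simp
    hence "(\<lambda>x::real. exp (- (1/2) * x)) absolutely_integrable_on {1..}"
      by (subst absolutely_integrable_on_iff_nonneg) auto
    hence "set_integrable lborel {1..} (\<lambda>x::real. exp (- (1/2) * x))"
      unfolding set_integrable_def by (subst (asm) integrable_completion) auto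
    hence "set_integrable lborel {1..} (\<lambda>x. ?h x * exp (- (1/2) * x))"
      using bd measq meas[of a] meas[of 0] by (intro bounded_mult_set_integrable) auto
    moreover have "(\<lambda>x. ?h x * exp (- (1/2) * x)) = (\<lambda>x. poly q x * jl_weight a \<alpha> \<beta> x)"
    proof
      fix x :: real
      have "exp (- (1/2) * x) * exp (- (1/2) * x) = exp (- x)" by (simp flip: exp_add)
      thus "?h x * exp (- (1/2) * x) = poly q x * jl_weight a \<alpha> \<beta> x"
        by (simp only: jl_weight_def mult.assoc)
    qed
    ultimately show ?thesis by simp
  qed
  have eq: "{a..} = {a..a/2} \<union> {a/2..1} \<union> {1..}" using \<open>a < 0\<close> by auto
  show ?thesis unfolding eq
    by (intro set_integrable_Un left mid right) auto
qed

lemma poly_jl_weight_set_integrable: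
  assumes "a < 0" "\<alpha> > -1" "\<beta> > -1" and "I = {a<..<0} \<or> I = {0<..}"
  shows "set_integrable lborel I (\<lambda>x. poly q x * jl_weight a \<alpha> \<beta> x)"
  using assms by (intro set_integrable_subset[OF poly_jl_weight_set_integrable_Ici[OF assms(1-3)]]) auto

section \<open>Orthogonality of the Rodrigues polynomials\<close>

lemma mult_abs_powr_tendsto_0:
  fixes \<gamma> s :: real
  assumes "\<gamma> > -1"
  shows "((\<lambda>x. (x - s) * \<bar>x - s\<bar> powr \<gamma>) \<longlongrightarrow> 0) (at s)"
proof (rule Lim_null_comparison)
  show "eventually (\<lambda>x. norm ((x - s) * \<bar>x - s\<bar> powr \<gamma>) \<le> \<bar>x - s\<bar> powr (\<gamma> + 1)) (at s)"
    by (intro always_eventually allI) (auto simp: abs_mult powr_add)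
  have "((\<lambda>x. \<bar>x - s\<bar>) \<longlongrightarrow> \<bar>s - s\<bar>) (at s)" by (intro tendsto_intros)
  from tendsto_powr'[OF this tendsto_const, of "\<gamma> + 1"] assms
  show "((\<lambda>x. \<bar>x - s\<bar> powr (\<gamma> + 1)) \<longlongrightarrow> 0) (at s)" by simp
qed

lemma poly_jl_weight_boundary:
  assumes "\<alpha> > -1" "\<beta> > -1" "a < 0"
  shows "((\<lambda>x. poly q x * ((x - a) * x * jl_weight a \<alpha> \<beta> x)) \<longlongrightarrow> 0) (at_right a)"
    "((\<lambda>x. poly q x * ((x - a) * x * jl_weight a \<alpha> \<beta> x)) \<longlongrightarrow> 0) (at 0)"
    "((\<lambda>x. poly q x * ((x - a) * x * jl_weight a \<alpha> \<beta> x)) \<longlongrightarrow> 0) at_top"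
proof -
  have "isCont (\<lambda>x. poly q x * x * (\<bar>x\<bar> powr \<beta> * exp (- x))) a"
    using \<open>a < 0\<close> by (intro continuous_intros) auto
  note tendsto_mult[OF mult_abs_powr_tendsto_0[OF \<open>\<alpha> > -1\<close>] this[unfolded isCont_def]]
  hence "((\<lambda>x. (x - a) * \<bar>x - a\<bar> powr \<alpha> * (poly q x * x * (\<bar>x\<bar> powr \<beta> * exp (- x)))) \<longlongrightarrow>
      0 * (poly q a * a * (\<bar>a\<bar> powr \<beta> * exp (- a)))) (at a)"
    .
  hence "((\<lambda>x. poly q x * ((x - a) * x * jl_weight a \<alpha> \<beta> x)) \<longlongrightarrow> 0) (at a)"
    by (simp add: jl_weight_def mult_ac)
  thus "((\<lambda>x. poly q x * ((x - a) * x * jl_weight a \<alpha> \<beta> x)) \<longlongrightarrow> 0) (at_right a)"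
    by (rule tendsto_mono[OF at_le, rotated]) auto
  have "isCont (\<lambda>x. poly q x * (x - a) * (\<bar>x - a\<bar> powr \<alpha> * exp (- x))) 0"
    using \<open>a < 0\<close> by (intro continuous_intros) auto
  note tendsto_mult[OF mult_abs_powr_tendsto_0[OF \<open>\<beta> > -1\<close>] this[unfolded isCont_def]]
  hence "((\<lambda>x. (x - 0) * \<bar>x - 0\<bar> powr \<beta> * (poly q x * (x - a) * (\<bar>x - a\<bar> powr \<alpha> * exp (- x)))) \<longlongrightarrow>
      0 * (poly q 0 * (0 - a) * (\<bar>0 - a\<bar> powr \<alpha> * exp (- 0)))) (at 0)"
    .
  thus "((\<lambda>x. poly q x * ((x - a) * x * jl_weight a \<alpha> \<beta> x)) \<longlongrightarrow> 0) (at 0)"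
    by (simp add: jl_weight_def mult_ac)
  show "((\<lambda>x. poly q x * ((x - a) * x * jl_weight a \<alpha> \<beta> x)) \<longlongrightarrow> 0) at_top"
    using poly_powr_exp_tendsto_0[of 1 "q * [:0, - a, 1:]" a \<alpha> \<beta>]
    by (simp add: jl_weight_def algebra_simps)
qed

lemma raise_weight_derivative:
  assumes "x > a" "x \<noteq> 0"
  shows "((\<lambda>x. poly g x * ((x - a) * x * jl_weight a \<alpha> \<beta> x)) has_vector_derivative
           poly (raise a \<alpha> \<beta> g) x * jl_weight a \<alpha> \<beta> x) (at x)"
proof -
  \<comment> \<open>Near \<open>x\<close> the absolute value is multiplication by a constant, which makes it differentiable.\<close>
  define s where "s = sgn x"
  have s: "s \<noteq> 0" "\<bar>x\<bar> = s * x" using assms by (auto simp: s_def sgn_if)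
  let ?w = "\<lambda>x. (x - a) powr \<alpha> * (s * x) powr \<beta> * exp (- x)"
  let ?f = "\<lambda>x. poly g x * ((x - a) * x * ?w x)"
  have "s * x > 0" using assms by (auto simp: s_def sgn_if)
  define l where "l = \<alpha> / (x - a) + \<beta> / x - 1"
  have l: "(x - a) * x * l = \<alpha> * x + \<beta> * (x - a) - (x - a) * x"
    using assms by (simp add: l_def divide_simps)
  have w: "(?w has_real_derivative ?w x * l) (at x)"
    unfolding l_def using assms \<open>s * x > 0\<close> s
    by (auto intro!: derivative_eq_intros simp: powr_diff field_simps)
  have lin: "((\<lambda>x. (x - a) * x) has_real_derivative (x + (x - a))) (at x)"
    by (auto intro!: derivative_eq_intros)
  have "(?f has_real_derivative
      (poly (pderiv g) x * ((x - a) * x) + poly g x * ((x - a) * x * l + (x + (x - a)))) * ?w x) (at x)"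
    by (rule DERIV_cong[OF DERIV_mult[OF poly_DERIV DERIV_mult[OF lin w]]]) (simp only: algebra_simps)
  also have "poly (pderiv g) x * ((x - a) * x) + poly g x * ((x - a) * x * l + (x + (x - a))) =
      poly (raise a \<alpha> \<beta> g) x"
    unfolding l by (simp add: raise_def algebra_simps)
  finally have "(?f has_real_derivative poly (raise a \<alpha> \<beta> g) x * ?w x) (at x)" .
  hence "(?f has_real_derivative poly (raise a \<alpha> \<beta> g) x * jl_weight a \<alpha> \<beta> x) (at x)"
    using assms s by (simp add: jl_weight_def)
  moreover have "eventually (\<lambda>z. ?f z = poly g z * ((z - a) * z * jl_weight a \<alpha> \<beta> z)) (nhds x)"
  proof -
    have "eventually (\<lambda>z. z \<in> {z. z > a} \<inter> {z. s * z > 0}) (nhds x)"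
      using assms \<open>s * x > 0\<close>
      by (intro eventually_nhds_in_open open_Int open_Collect_less continuous_intros) auto
    thus ?thesis
      by eventually_elim (auto simp: jl_weight_def s_def sgn_if split: if_splits)
  qed
  ultimately show ?thesis
    by (simp add: has_real_derivative_iff_has_vector_derivative[symmetric] DERIV_cong_ev)
qed

text \<open>
  The integrand is the derivative of \<open>g(x) (x - a) x w(x)\<close>, which tends to \<open>0\<close> at \<open>a\<close> and at \<open>0\<close>
  because \<open>\<alpha> + 1 > 0\<close> and \<open>\<beta> + 1 > 0\<close>, and at \<open>\<infinity>\<close> because of the exponential.
\<close>

lemma set_integral_raise_weight_eq_0:
  assumes "a < 0" "\<alpha> > -1" "\<beta> > -1" and I: "I = {a<..<0} \<or> I = {0<..}"
  shows "(LBINT x:I. poly (raise a \<alpha> \<beta> g) x * jl_weight a \<alpha> \<beta> x) = 0"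
proof -
  let ?F = "\<lambda>x. poly g x * ((x - a) * x * jl_weight a \<alpha> \<beta> x)"
  let ?f = "\<lambda>x. poly (raise a \<alpha> \<beta> g) x * jl_weight a \<alpha> \<beta> x"
  have cont: "isCont ?f x" if "x > a" "x \<noteq> 0" for x
    unfolding jl_weight_def using that by (intro continuous_intros) auto
  have int: "set_integrable lborel J ?f" if "J \<subseteq> {a..}" "J \<in> sets borel" for J
    using set_integrable_subset[OF poly_jl_weight_set_integrable_Ici[OF assms(1-3)]] that by auto
  note lim = poly_jl_weight_boundary[OF assms(2,3,1), of g]
  from I show ?thesis
  proof
    assume I: "I = {a<..<0}"
    have "(LBINT x=ereal a..ereal 0. ?f x) = 0 - 0"
    proof (rule interval_integral_FTC_integrable)
      show "(?F has_vector_derivative ?f x) (at x)" "isCont ?f x"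
        if "ereal a < ereal x" "ereal x < ereal 0" for x
        using that raise_weight_derivative cont by auto
      show "((?F \<circ> real_of_ereal) \<longlongrightarrow> 0) (at_right (ereal a))"
        unfolding ereal_tendsto_simps by (rule lim(1))
      show "((?F \<circ> real_of_ereal) \<longlongrightarrow> 0) (at_left (ereal 0))"
        unfolding ereal_tendsto_simps by (rule tendsto_mono[OF at_le lim(2)]) auto
      show "set_integrable lborel (einterval (ereal a) (ereal 0)) ?f"
        unfolding einterval_eq by (rule int) auto
    qed (use \<open>a < 0\<close> in auto)
    thus ?thesis using \<open>a < 0\<close> by (simp add: I interval_lebesgue_integral_def)
  next
    assume I: "I = {0<..}"
    have "(LBINT x=ereal 0..\<infinity>. ?f x) = 0 - 0"
    proof (rule interval_integral_FTC_integrable)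
      show "(?F has_vector_derivative ?f x) (at x)" "isCont ?f x"
        if "ereal 0 < ereal x" "ereal x < \<infinity>" for x
        using that \<open>a < 0\<close> raise_weight_derivative cont by auto
      show "((?F \<circ> real_of_ereal) \<longlongrightarrow> 0) (at_left \<infinity>)"
        unfolding ereal_tendsto_simps by (rule lim(3))
      show "((?F \<circ> real_of_ereal) \<longlongrightarrow> 0) (at_right (ereal 0))"
        unfolding ereal_tendsto_simps by (rule tendsto_mono[OF at_le lim(2)]) auto
      show "set_integrable lborel (einterval (ereal 0) \<infinity>) ?f"
        unfolding einterval_eq using \<open>a < 0\<close> by (intro int) auto
    qed auto
    thus ?thesis by (simp add: I interval_lebesgue_integral_def)
  qed
qed

text \<open>
  Integration by parts moves the raising operator to a derivative of the test polynomial \<open>q\<close> and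
  shifts both parameters by one. The degree of \<open>q\<close> drops together with \<open>n\<close>.
\<close>

lemma jl_rodrigues_orthogonal:
  assumes "a < 0" "\<alpha> > -1" "\<beta> > -1" and I: "I = {a<..<0} \<or> I = {0<..}" and "degree q < n"
  shows "(LBINT x:I. poly (q * jl_rodrigues a n \<alpha> \<beta>) x * jl_weight a \<alpha> \<beta> x) = 0"
  using assms(2,3,5)
proof (induction n arbitrary: \<alpha> \<beta> q)
  case (Suc n)
  define L where "L = jl_rodrigues a n (\<alpha> + 1) (\<beta> + 1)"
  \<comment> \<open>\<open>\<sigma>\<close> is the sign of \<open>x\<close> on \<open>I\<close>: the shifted weight has the factor \<open>\<bar>x\<bar>\<close> where the derivative has \<open>x\<close>.\<close>
  define \<sigma> :: real where "\<sigma> = (if I = {0<..} then 1 else -1)"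
  have int: "set_integrable lborel I (\<lambda>x. poly p x * jl_weight a \<alpha> \<beta> x)" for p
    by (rule poly_jl_weight_set_integrable[OF \<open>a < 0\<close> Suc.prems(1,2) I])
  have prod_rule: "poly (q * jl_rodrigues a (Suc n) \<alpha> \<beta>) x * jl_weight a \<alpha> \<beta> x =
      poly (pderiv q * L * [:0, - a, 1:]) x * jl_weight a \<alpha> \<beta> x - poly (raise a \<alpha> \<beta> (q * L)) x * jl_weight a \<alpha> \<beta> x" for x
    by (simp add: L_def raise_def pderiv_mult algebra_simps)
  have shift: "poly (pderiv q * L * [:0, - a, 1:]) x * jl_weight a \<alpha> \<beta> x =
      \<sigma> * (poly (pderiv q * L) x * jl_weight a (\<alpha> + 1) (\<beta> + 1) x)" if "x \<in> I" for x
  proof -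
    have "\<bar>x - a\<bar> = x - a" using that I \<open>a < 0\<close> by auto
    moreover have "\<bar>x\<bar> = \<sigma> * x"
      using that I by (cases "x > 0") (auto simp: \<sigma>_def)
    moreover have "jl_weight a (\<alpha> + 1) (\<beta> + 1) x = \<bar>x - a\<bar> * \<bar>x\<bar> * jl_weight a \<alpha> \<beta> x"
      by (simp add: jl_weight_def powr_add)
    ultimately have weight: "jl_weight a (\<alpha> + 1) (\<beta> + 1) x = \<sigma> * ((x - a) * x * jl_weight a \<alpha> \<beta> x)" by simp
    have poly: "poly (pderiv q * L * [:0, - a, 1:]) x = poly (pderiv q * L) x * ((x - a) * x)"
      by (simp add: algebra_simps)
    have "\<sigma> = 1 \<or> \<sigma> = -1" by (simp add: \<sigma>_def)
    thus ?thesis unfolding weight poly by (auto simp: algebra_simps)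
  qed
  have "(LBINT x:I. poly (pderiv q * L) x * jl_weight a (\<alpha> + 1) (\<beta> + 1) x) = 0"
  proof (cases "degree q = 0")
    case True
    hence "pderiv q = 0" by (simp add: pderiv_eq_0_iff)
    thus ?thesis by simp
  next
    case False
    hence "degree (pderiv q) < n" using Suc.prems by (simp add: degree_pderiv)
    thus ?thesis unfolding L_def using Suc.prems by (intro Suc.IH) auto
  qed
  moreover have "(LBINT x:I. poly (pderiv q * L * [:0, - a, 1:]) x * jl_weight a \<alpha> \<beta> x) =
      (LBINT x:I. \<sigma> * (poly (pderiv q * L) x * jl_weight a (\<alpha> + 1) (\<beta> + 1) x))"
  proof (rule set_lebesgue_integral_cong)
    show "I \<in> sets lborel" using I by auto
  qed (use shift in blast)
  ultimately have "(LBINT x:I. poly (pderiv q * L * [:0, - a, 1:]) x * jl_weight a \<alpha> \<beta> x) = 0"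
    by (simp only: set_integral_mult_right)
  thus ?case
    unfolding prod_rule
    using set_integral_raise_weight_eq_0[OF \<open>a < 0\<close> Suc.prems(1,2) I]
    by (subst set_integral_diff(2)[OF int int]) simp
qed simp

section \<open>Uniqueness\<close>

definition constant_sign_on :: "real set \<Rightarrow> real poly \<Rightarrow> bool" where
  "constant_sign_on I p \<longleftrightarrow> (\<forall>x\<in>I. 0 \<le> poly p x) \<or> (\<forall>x\<in>I. poly p x \<le> 0)"

text \<open>
  The set \<open>S\<close> consists of the zeros of odd multiplicity in \<open>I\<close>. Removing one linear factor \<open>x - z\<close>
  from \<open>r\<close> toggles the membership of \<open>z\<close> in \<open>S\<close>, which gives the induction on the degree.
\<close>

lemma poly_times_linear_factors_constant_sign:
  fixes r :: "real poly"
  assumes "r \<noteq> 0" and conn: "\<And>x y. x \<in> I \<Longrightarrow> y \<in> I \<Longrightarrow> {x..y} \<subseteq> I"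
  shows "\<exists>S. finite S \<and> S \<subseteq> {x \<in> I. poly r x = 0} \<and>
     constant_sign_on I (r * (\<Prod>s\<in>S. [:- s, 1:]))"
  using assms(1)
proof (induction "degree r" arbitrary: r rule: less_induct)
  case less
  show ?case
  proof (cases "\<exists>z\<in>I. poly r z = 0")
    case False
    have "0 < poly r x \<and> 0 < poly r y \<or> poly r x < 0 \<and> poly r y < 0" if "x \<in> I" "y \<in> I" "x \<le> y" for x y
    proof (rule ccontr)
      assume "\<not> ?thesis"
      hence "x < y" "poly r x * poly r y < 0"
        using False that by (auto simp: mult_less_0_iff not_less order_le_less)
      from poly_IVT[OF this] obtain z where "x < z" "z < y" "poly r z = 0" by auto
      hence "z \<in> {x..y}" by simp
      hence "z \<in> I" using conn[OF that(1,2)] by blast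
      thus False using False \<open>poly r z = 0\<close> by blast
    qed
    hence same: "0 < poly r x \<and> 0 < poly r y \<or> poly r x < 0 \<and> poly r y < 0" if "x \<in> I" "y \<in> I" for x y
      using that by (cases "x \<le> y") force+
    have "constant_sign_on I r"
    proof (cases "\<exists>x\<in>I. 0 < poly r x")
      case True
      then obtain x where "x \<in> I" "0 < poly r x" by blast
      thus ?thesis unfolding constant_sign_on_def using same[of x] by force
    qed (auto simp: constant_sign_on_def not_less)
    thus ?thesis by (intro exI[of _ "{}"]) simp
  next
    case True
    then obtain z where z: "z \<in> I" "poly r z = 0" by blast
    then obtain r' where r': "r = [:- z, 1:] * r'" by (auto simp: poly_eq_0_iff_dvd)
    have "r' \<noteq> 0" using less.prems r' by auto
    moreover from this have "degree r' < degree r" unfolding r' by (subst degree_mult_eq) auto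
    ultimately have "\<exists>S. finite S \<and> S \<subseteq> {x \<in> I. poly r' x = 0} \<and> constant_sign_on I (r' * (\<Prod>s\<in>S. [:- s, 1:]))"
      by (rule less.hyps[rotated])
    then obtain S where S: "finite S" "S \<subseteq> {x \<in> I. poly r' x = 0}"
      "constant_sign_on I (r' * (\<Prod>s\<in>S. [:- s, 1:]))"
      by blast
    show ?thesis
    proof (cases "z \<in> S")
      case True
      have "r * (\<Prod>s\<in>S - {z}. [:- s, 1:]) = r' * (\<Prod>s\<in>S. [:- s, 1:])"
        unfolding r' prod.remove[OF S(1) True] by (simp only: mult_ac)
      thus ?thesis using S by (intro exI[of _ "S - {z}"] conjI) (auto simp: r')
    next
      case False
      have "poly (r * (\<Prod>s\<in>insert z S. [:- s, 1:])) x = (x - z)\<^sup>2 * poly (r' * (\<Prod>s\<in>S. [:- s, 1:])) x" for x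
        unfolding r' prod.insert[OF S(1) False] poly_mult by (simp add: power2_eq_square algebra_simps)
      hence "constant_sign_on I (r * (\<Prod>s\<in>insert z S. [:- s, 1:]))"
        using S(3) unfolding constant_sign_on_def by (simp only: zero_le_mult_iff mult_le_0_iff) auto
      thus ?thesis using S z
        by (intro exI[of _ "insert z S"] conjI) (auto simp: r')
    qed
  qed
qed

lemma poly_eq_0_of_integral_eq_0:
  assumes "a < 0" "\<alpha> > -1" "\<beta> > -1" and I: "I = {a<..<0} \<or> I = {0<..}"
    and sign: "\<And>x. x \<in> I \<Longrightarrow> 0 \<le> poly p x"
    and "(LBINT x:I. poly p x * jl_weight a \<alpha> \<beta> x) = 0"
  shows "p = 0"
proof (rule ccontr)
  assume "p \<noteq> 0"
  have int: "set_integrable lborel I (\<lambda>x. poly p x * jl_weight a \<alpha> \<beta> x)"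
    by (rule poly_jl_weight_set_integrable[OF assms(1-4)])
  have "AE x in lborel. indicator I x *\<^sub>R (poly p x * jl_weight a \<alpha> \<beta> x) = 0"
  proof (rule integral_nonneg_eq_0_iff_AE[THEN iffD1])
    show "integrable lborel (\<lambda>x. indicator I x *\<^sub>R (poly p x * jl_weight a \<alpha> \<beta> x))"
      using int by (simp add: set_integrable_def)
    show "(\<integral>x. indicator I x *\<^sub>R (poly p x * jl_weight a \<alpha> \<beta> x) \<partial>lborel) = 0"
      using assms(6) by (simp add: set_lebesgue_integral_def)
  qed (use sign in \<open>auto simp: indicator_def jl_weight_def\<close>)
  moreover have "AE x in lborel. x \<notin> {x. poly p x = 0}"
    using poly_roots_finite[OF \<open>p \<noteq> 0\<close>] by (intro AE_not_in finite_imp_null_set_lborel)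
  ultimately have "AE x in lborel. x \<notin> I"
  proof eventually_elim
    case (elim x)
    show ?case
    proof
      assume "x \<in> I"
      hence "jl_weight a \<alpha> \<beta> x > 0" using I \<open>a < 0\<close> by (auto simp: jl_weight_def)
      thus False using elim \<open>x \<in> I\<close> by simp
    qed
  qed
  hence "emeasure lborel I = 0" using I by (subst (asm) AE_iff_measurable[of I]) auto
  moreover have "emeasure lborel I > 0"
  proof -
    obtain c d :: real where "c < d" "{c<..<d} \<subseteq> I" "I \<in> sets lborel"
    proof (cases "I = {0<..}")
      case True
      show ?thesis by (rule that[of 0 1]) (auto simp: True)
    next
      case False
      hence "I = {a<..<0}" using I by blast
      show ?thesis by (rule that[of a 0]) (auto simp: \<open>I = {a<..<0}\<close> \<open>a < 0\<close>)
    qed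
    hence "emeasure lborel {c<..<d} \<le> emeasure lborel I" by (intro emeasure_mono)
    moreover have "emeasure lborel {c<..<d} > 0" using \<open>c < d\<close> by simp
    ultimately show ?thesis by (rule order.strict_trans2[rotated])
  qed
  ultimately show False by simp
qed

text \<open>
  If \<open>r\<close> had fewer than \<open>n\<close> zeros in one of the two intervals, multiplying it by the linear factors
  of those with odd multiplicity would give an integrand of constant sign with integral \<open>0\<close>. So \<open>r\<close>
  has at least \<open>2 * n\<close> zeros, which exceeds its degree.
\<close>

lemma orthogonal_eq_0:
  assumes "a < 0" "\<alpha> > -1" "\<beta> > -1" and "degree r < 2 * n"
    and orth: "\<And>I q. I = {a<..<0} \<or> I = {0<..} \<Longrightarrow> degree q < n \<Longrightarrow>
      (LBINT x:I. poly (q * r) x * jl_weight a \<alpha> \<beta> x) = 0"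
  shows "r = 0"
proof (rule ccontr)
  assume "r \<noteq> 0"
  have many: "n \<le> card {x \<in> I. poly r x = 0}" if I: "I = {a<..<0} \<or> I = {0<..}" for I
  proof (rule ccontr)
    assume few: "\<not> ?thesis"
    have "{x..y} \<subseteq> I" if "x \<in> I" "y \<in> I" for x y using that I by auto
    from poly_times_linear_factors_constant_sign[OF \<open>r \<noteq> 0\<close> this]
    obtain S where S: "finite S" "S \<subseteq> {x \<in> I. poly r x = 0}"
       "constant_sign_on I (r * (\<Prod>s\<in>S. [:- s, 1:]))"
      by blast
    define q where "q = (\<Prod>s\<in>S. [:- s, 1:])"
    have "finite {x \<in> I. poly r x = 0}"
      using poly_roots_finite[OF \<open>r \<noteq> 0\<close>] by simp
    hence "card S < n" using card_mono[OF _ S(2)] few by linarith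
    hence "degree q < n" unfolding q_def by (subst degree_prod_eq_sum_degree) auto
    from orth[OF I this] have 0: "(LBINT x:I. poly (q * r) x * jl_weight a \<alpha> \<beta> x) = 0" .
    hence 1: "(LBINT x:I. poly (- (q * r)) x * jl_weight a \<alpha> \<beta> x) = 0"
      by (simp add: set_lebesgue_integral_def)
    have "q * r = 0"
      using S(3) poly_eq_0_of_integral_eq_0[OF assms(1-3) I _ 0] poly_eq_0_of_integral_eq_0[OF assms(1-3) I _ 1]
      unfolding constant_sign_on_def q_def[symmetric] by (auto simp: mult.commute)
    moreover have "q \<noteq> 0" unfolding q_def using S(1) by (simp add: prod_zero_iff)
    ultimately show False using \<open>r \<noteq> 0\<close> by simp
  qed
  have fin: "finite {x. poly r x = 0}" using poly_roots_finite[OF \<open>r \<noteq> 0\<close>] .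
  have "2 * n \<le> card {x \<in> {a<..<0}. poly r x = 0} + card {x \<in> {0<..}. poly r x = 0}"
    using many[of "{a<..<0}"] many[of "{0<..}"] by simp
  also have "\<dots> = card ({x \<in> {a<..<0}. poly r x = 0} \<union> {x \<in> {0<..}. poly r x = 0})"
    using fin by (intro card_Un_disjoint[symmetric]) auto
  also have "\<dots> \<le> card {x. poly r x = 0}"
    using fin by (intro card_mono) auto
  also have "\<dots> \<le> degree r" using \<open>r \<noteq> 0\<close> by (rule card_poly_roots_bound)
  finally show False using \<open>degree r < 2 * n\<close> by simp
qed

section \<open>Monotonicity of the zeros\<close>

lemma is_jacobi_laguerre_iff:
  assumes "a < 0"
  shows "is_jacobi_laguerre n \<alpha> \<beta> a p \<longleftrightarrow> degree p = 2 * n \<and> lead_coeff p = 1 \<and>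
    (\<forall>I. I = {a<..<0} \<or> I = {0<..} \<longrightarrow>
      (\<forall>k<n. (LBINT x:I. poly (monom 1 k * p) x * jl_weight a \<alpha> \<beta> x) = 0))"
proof -
  have "(LBINT x:{a<..<0}. x ^ k * poly p x * (x - a) powr \<alpha> * \<bar>x\<bar> powr \<beta> * exp (- x)) =
      (LBINT x:{a<..<0}. poly (monom 1 k * p) x * jl_weight a \<alpha> \<beta> x)" for k
    by (rule set_lebesgue_integral_cong) (auto simp: jl_weight_def poly_monom)
  moreover have "(LBINT x:{0<..}. x ^ k * poly p x * (x - a) powr \<alpha> * x powr \<beta> * exp (- x)) =
      (LBINT x:{0<..}. poly (monom 1 k * p) x * jl_weight a \<alpha> \<beta> x)" for k
    using assms by (intro set_lebesgue_integral_cong) (auto simp: jl_weight_def poly_monom)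
  ultimately show ?thesis unfolding is_jacobi_laguerre_def by auto
qed

lemma orthogonal_to_monomials_imp_orthogonal:
  assumes "a < 0" "\<alpha> > -1" "\<beta> > -1" and I: "I = {a<..<0} \<or> I = {0<..}"
    and orth: "\<And>k. k < n \<Longrightarrow> (LBINT x:I. poly (monom 1 k * r) x * jl_weight a \<alpha> \<beta> x) = 0"
    and "degree q < n"
  shows "(LBINT x:I. poly (q * r) x * jl_weight a \<alpha> \<beta> x) = 0"
proof -
  let ?f = "\<lambda>k x. indicator I x *\<^sub>R (poly (monom 1 k * r) x * jl_weight a \<alpha> \<beta> x)"
  have int: "integrable lborel (?f k)" for k
    using poly_jl_weight_set_integrable[OF assms(1-4)] unfolding set_integrable_def .
  have "indicator I x *\<^sub>R (poly (q * r) x * jl_weight a \<alpha> \<beta> x) = (\<Sum>k\<le>degree q. coeff q k * ?f k x)" for x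
    by (simp add: poly_altdef[of q] poly_monom sum_distrib_left sum_distrib_right mult_ac)
  hence "(LBINT x:I. poly (q * r) x * jl_weight a \<alpha> \<beta> x) = (\<integral>x. (\<Sum>k\<le>degree q. coeff q k * ?f k x) \<partial>lborel)"
    unfolding set_lebesgue_integral_def by (simp only:)
  also have "\<dots> = (\<Sum>k\<le>degree q. \<integral>x. coeff q k * ?f k x \<partial>lborel)"
    by (intro Bochner_Integration.integral_sum integrable_mult_right int)
  also have "\<dots> = (\<Sum>k\<le>degree q. coeff q k * 0)"
  proof (intro sum.cong refl)
    fix k assume "k \<in> {..degree q}"
    hence "(\<integral>x. ?f k x \<partial>lborel) = 0"
      using orth[of k] \<open>degree q < n\<close> by (simp add: set_lebesgue_integral_def)
    thus "(\<integral>x. coeff q k * ?f k x \<partial>lborel) = coeff q k * 0"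
      by (simp only: integral_mult_right_zero)
  qed
  finally show ?thesis by simp
qed

lemma jacobi_laguerre_eq_jl_rodrigues:
  assumes "n \<ge> 1" "a < 0" "\<alpha> > -1" "\<beta> > -1"
  shows "jacobi_laguerre n \<alpha> \<beta> a = jl_rodrigues a n \<alpha> \<beta>"
  unfolding jacobi_laguerre_def
proof (rule the_equality)
  have "(LBINT x:I. poly (monom 1 k * jl_rodrigues a n \<alpha> \<beta>) x * jl_weight a \<alpha> \<beta> x) = 0"
    if "I = {a<..<0} \<or> I = {0<..}" "k < n" for I k
    using that by (intro jl_rodrigues_orthogonal[OF assms(2-4)]) (auto simp: degree_monom_eq)
  thus is_jl: "is_jacobi_laguerre n \<alpha> \<beta> a (jl_rodrigues a n \<alpha> \<beta>)"
    unfolding is_jacobi_laguerre_iff[OF \<open>a < 0\<close>]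
    using jl_rodrigues_monic[of a n \<alpha> \<beta>] by blast
  fix p assume p: "is_jacobi_laguerre n \<alpha> \<beta> a p"
  define r where "r = p - jl_rodrigues a n \<alpha> \<beta>"
  note props = p[unfolded is_jacobi_laguerre_iff[OF \<open>a < 0\<close>]] is_jl[unfolded is_jacobi_laguerre_iff[OF \<open>a < 0\<close>]]
  have monic: "degree p = 2 * n" "coeff p (2 * n) = 1" "degree (jl_rodrigues a n \<alpha> \<beta>) = 2 * n"
    "coeff (jl_rodrigues a n \<alpha> \<beta>) (2 * n) = 1"
    using props by metis+
  have "degree r < 2 * n"
  proof (rule degree_lessI)
    show "r \<noteq> 0 \<or> 2 * n > 0" using \<open>n \<ge> 1\<close> by simp
    show "\<forall>k\<ge>2 * n. coeff r k = 0"
    proof (intro allI impI)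
      fix k assume "2 * n \<le> k"
      thus "coeff r k = 0"
        using monic by (cases "k = 2 * n") (simp_all add: r_def coeff_eq_0)
    qed
  qed
  have mono: "(LBINT x:I. poly (monom 1 k * r) x * jl_weight a \<alpha> \<beta> x) = 0"
    if I: "I = {a<..<0} \<or> I = {0<..}" and "k < n" for I k
  proof -
    have int: "set_integrable lborel I (\<lambda>x. poly q x * jl_weight a \<alpha> \<beta> x)" for q
      by (rule poly_jl_weight_set_integrable[OF assms(2-4) I])
    have "poly (monom 1 k * r) x * jl_weight a \<alpha> \<beta> x = poly (monom 1 k * p) x * jl_weight a \<alpha> \<beta> x -
        poly (monom 1 k * jl_rodrigues a n \<alpha> \<beta>) x * jl_weight a \<alpha> \<beta> x" for x
      by (simp add: r_def algebra_simps)
    hence "(LBINT x:I. poly (monom 1 k * r) x * jl_weight a \<alpha> \<beta> x) =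
        (LBINT x:I. poly (monom 1 k * p) x * jl_weight a \<alpha> \<beta> x) -
        (LBINT x:I. poly (monom 1 k * jl_rodrigues a n \<alpha> \<beta>) x * jl_weight a \<alpha> \<beta> x)"
      by (simp only: set_integral_diff(2)[OF int int])
    moreover have "(LBINT x:I. poly (monom 1 k * p) x * jl_weight a \<alpha> \<beta> x) = 0"
      "(LBINT x:I. poly (monom 1 k * jl_rodrigues a n \<alpha> \<beta>) x * jl_weight a \<alpha> \<beta> x) = 0"
      using props that by blast+
    ultimately show ?thesis by simp
  qed
  have "(LBINT x:I. poly (q * r) x * jl_weight a \<alpha> \<beta> x) = 0"
    if I: "I = {a<..<0} \<or> I = {0<..}" and q: "degree q < n" for I q
    using orthogonal_to_monomials_imp_orthogonal[OF assms(2-4) I mono[OF I] q] .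
  from orthogonal_eq_0[OF assms(2-4) \<open>degree r < 2 * n\<close> this] have "r = 0" .
  thus "p = jl_rodrigues a n \<alpha> \<beta>" by (simp add: r_def)
qed

theorem corollary3p2:
  fixes n :: nat and a \<beta> :: real
  assumes "n \<ge> 1" and "a < 0" and "\<beta> > -1"
  shows "\<forall>j\<in>{1..2 * n}. strict_mono_on {-1<..} (\<lambda>\<alpha>. jacobi_laguerre_zero n \<alpha> \<beta> a j)"
proof (intro ballI strict_mono_onI)
  fix j and \<alpha> \<alpha>' :: real
  assume j: "j \<in> {1..2 * n}" and \<alpha>: "\<alpha> \<in> {-1<..}" "\<alpha>' \<in> {-1<..}" "\<alpha> < \<alpha>'"
  hence "j - 1 < 2 * n" "\<alpha> > -1" "\<alpha>' > -1" by auto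
  obtain y y' where y: "separated_zeros a n (jl_rodrigues a n \<alpha> \<beta>) y"
    and y': "separated_zeros a n (jl_rodrigues a n \<alpha>' \<beta>) y'" and less: "\<forall>i<2 * n. y i < y' i"
    using jl_rodrigues_zeros_increasing[OF \<open>a < 0\<close> \<open>\<alpha> > -1\<close> \<open>\<alpha> < \<alpha>'\<close> \<open>\<beta> > -1\<close>] by blast
  have "jacobi_laguerre_zero n \<alpha> \<beta> a j = y (j - 1)"
    unfolding jacobi_laguerre_zero_def
      jacobi_laguerre_eq_jl_rodrigues[OF \<open>n \<ge> 1\<close> \<open>a < 0\<close> \<open>\<alpha> > -1\<close> \<open>\<beta> > -1\<close>]
    by (rule nth_sorted_zeros[OF y \<open>j - 1 < 2 * n\<close>])
  moreover have "jacobi_laguerre_zero n \<alpha>' \<beta> a j = y' (j - 1)"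
    unfolding jacobi_laguerre_zero_def
      jacobi_laguerre_eq_jl_rodrigues[OF \<open>n \<ge> 1\<close> \<open>a < 0\<close> \<open>\<alpha>' > -1\<close> \<open>\<beta> > -1\<close>]
    by (rule nth_sorted_zeros[OF y' \<open>j - 1 < 2 * n\<close>])
  ultimately show "jacobi_laguerre_zero n \<alpha> \<beta> a j < jacobi_laguerre_zero n \<alpha>' \<beta> a j"
    using less \<open>j - 1 < 2 * n\<close> by simp
qed

end
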